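(* Let $G$ be a graph on $n$ vertices with maximum degree $\Delta>0$. Then every locally $\frac{n-2}{22.4\,\Delta^2}$-bounded edge colouring $\chi$ of the complete graph $K_n$ is $G$-proper, that is, $K_n$ contains a copy of $G$ which is properly coloured by $\chi$.
   Context: Graphs are finite and simple. An edge colouring is an arbitrary assignment of colours to edges (not necessarily proper). For a real number $k$, an edge colouring $\chi$ of a graph $F$ is locally $k$-bounded if for every vertex $v$ of $F$ no colour is used by $\chi$ more than $k$ times on the edges of $F$ incident to $v$. For an $n$-vertex graph $G$, a copy of $G$ in $K_n$ is the image of $G$ under an injection $\sigma\colon V(G)\to V(K_n)$, with edges $\sigma(x)\sigma(y)$ for $xy\in E(G)$. A copy is properly coloured by $\chi$ if any two distinct edges of the copy sharing a vertex receive different colours from $\chi$. A colouring $\chi$ of the edges of $K_n$ is $G$-proper if $K_n$ contains a copy of $G$ which is properly coloured by $\chi$. *)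

theory Defs
  imports Complex_Main
begin

type_synonym 'a graph = "'a set \<times> 'a set set"

abbreviation vset :: "'a graph \<Rightarrow> 'a set" where
  "vset G \<equiv> fst G"

abbreviation eset :: "'a graph \<Rightarrow> 'a set set" where
  "eset G \<equiv> snd G"

definition finite_simple_graph :: "'a graph \<Rightarrow> bool" where
  "finite_simple_graph G \<longleftrightarrow>
     finite (vset G) \<and> (\<forall>e \<in> eset G. e \<subseteq> vset G \<and> card e = 2)"

definition vertex_degree :: "'a graph \<Rightarrow> 'a \<Rightarrow> nat" where
  "vertex_degree G v = card {e \<in> eset G. v \<in> e}"

text \<open>Inserting \<open>0\<close> only matters for the graph without vertices, where \<open>Max {}\<close> is unspecified.\<close>

definition max_degree :: "'a graph \<Rightarrow> nat" where
  "max_degree G = Max (insert 0 (vertex_degree G ` vset G))"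

definition complete_graph :: "nat \<Rightarrow> nat graph" where
  "complete_graph n = ({..<n}, {e. e \<subseteq> {..<n} \<and> card e = 2})"

text \<open>An edge colouring of a graph is a function on all vertex sets of which only the values on
  the edges are ever used. The type of colours is arbitrary.\<close>

definition locally_bounded :: "real \<Rightarrow> 'a graph \<Rightarrow> ('a set \<Rightarrow> 'c) \<Rightarrow> bool" where
  "locally_bounded k F \<chi> \<longleftrightarrow>
     (\<forall>v \<in> vset F. \<forall>c. real (card {e \<in> eset F. v \<in> e \<and> \<chi> e = c}) \<le> k)"

definition is_copy_in :: "'a graph \<Rightarrow> 'b graph \<Rightarrow> 'b graph \<Rightarrow> bool" where
  "is_copy_in G K H \<longleftrightarrow>
     (\<exists>\<sigma>. inj_on \<sigma> (vset G) \<and> \<sigma> ` vset G \<subseteq> vset K \<and>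
          H = (\<sigma> ` vset G, (\<lambda>e. \<sigma> ` e) ` eset G))"

definition properly_coloured :: "('a set \<Rightarrow> 'c) \<Rightarrow> 'a graph \<Rightarrow> bool" where
  "properly_coloured \<chi> H \<longleftrightarrow>
     (\<forall>e \<in> eset H. \<forall>f \<in> eset H. e \<noteq> f \<and> e \<inter> f \<noteq> {} \<longrightarrow> \<chi> e \<noteq> \<chi> f)"

definition graph_proper :: "nat \<Rightarrow> 'a graph \<Rightarrow> (nat set \<Rightarrow> 'c) \<Rightarrow> bool" where
  "graph_proper n G \<chi> \<longleftrightarrow>
     (\<exists>H. is_copy_in G (complete_graph n) H \<and> properly_coloured \<chi> H)"

end

theory Submission
  imports Defs "HOL-Library.FuncSet"
begin

text \<open>Take a uniformly random bijection \<open>\<sigma>\<close> of the vertices. The bad events are \<open>\<sigma> x = u\<close>, \<open>\<sigma> y = v\<close>,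
  \<open>\<sigma> z = w\<close> for a path \<open>xyz\<close> in \<open>G\<close> and a monochromatic path \<open>uvw\<close> in \<open>K\<^sub>n\<close>; each has probability
  \<open>1 / (n (n - 1) (n - 2))\<close>. An event is negatively correlated with the avoidance of any events that
  share neither a vertex of \<open>G\<close> nor a vertex of \<open>K\<^sub>n\<close> with it, so the lopsided local lemma applies.
  Its classical form gives too weak a constant. In the cluster expansion form (Bissacot, Fernandez,
  Procacci, Scoppola) the neighbourhood of an event enters through its independence polynomial.
  The neighbourhood is covered by six cliques, one for each of the vertices involved, and each of
  them has at most \<open>N = 3/2 \<Delta>\<^sup>2 n (n - 1) k\<close> events. Giving every event the weight \<open>1 / (5 N)\<close>, the
  criterion becomes \<open>5 N (6/5)\<^sup>6 \<le> n (n - 1) (n - 2)\<close>, and \<open>3/2 \<cdot> 5 \<cdot> (6/5)\<^sup>6 < 22.4\<close>.\<close>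

section \<open>Independence polynomials of a conflict graph\<close>

definition indep :: "('i \<Rightarrow> 'i \<Rightarrow> bool) \<Rightarrow> 'i set \<Rightarrow> bool" where
  "indep adj J \<longleftrightarrow> (\<forall>a\<in>J. \<forall>b\<in>J. a \<noteq> b \<longrightarrow> \<not> adj a b)"

text \<open>The multivariate independence polynomial of the graph that \<open>adj\<close> induces on
  \<open>T\<close>, also known as the partition function of the hard-core model.\<close>

definition indep_poly :: "('i \<Rightarrow> 'i \<Rightarrow> bool) \<Rightarrow> ('i \<Rightarrow> real) \<Rightarrow> 'i set \<Rightarrow> real" where
  "indep_poly adj \<mu> T = (\<Sum>J | J \<subseteq> T \<and> indep adj J. \<Prod>j\<in>J. \<mu> j)"

text \<open>Reflexivity makes \<open>{b. adj a b}\<close> the closed neighbourhood of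
  \<open>a\<close>, so \<open>nonadj a\<close> leaves out \<open>a\<close> itself.\<close>

locale weighted_conflicts =
  fixes adj :: "'i \<Rightarrow> 'i \<Rightarrow> bool" and \<mu> :: "'i \<Rightarrow> real"
  assumes adj_refl: "adj a a"
    and adj_sym: "adj a b \<Longrightarrow> adj b a"
    and weight_nonneg: "\<mu> a \<ge> 0"
begin

abbreviation Y :: "'i set \<Rightarrow> real" where
  "Y \<equiv> indep_poly adj \<mu>"

abbreviation nonadj :: "'i \<Rightarrow> 'i set" where
  "nonadj a \<equiv> {b. \<not> adj a b}"

lemma Y_empty [simp]: "Y {} = 1"
proof -
  have "{J. J \<subseteq> {} \<and> indep adj J} = {{}}"
    by (auto simp: indep_def)
  then show ?thesis by (simp add: indep_poly_def)
qed

lemma Y_mono: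
  assumes "finite T" "S \<subseteq> T"
  shows "Y S \<le> Y T"
  unfolding indep_poly_def
  using assms by (intro sum_mono2) (auto intro: prod_nonneg weight_nonneg)

lemma Y_ge_1: "finite T \<Longrightarrow> Y T \<ge> 1"
  using Y_mono[of T "{}"] by simp

text \<open>Independent sets are split by whether they contain \<open>a\<close>; removing
  \<open>a\<close> from those that do leaves exactly the independent sets of non-neighbours of
  \<open>a\<close>.\<close>

lemma Y_rec:
  assumes "finite T" "a \<in> T"
  shows "Y T = Y (T - {a}) + \<mu> a * Y (T \<inter> nonadj a)"
proof -
  let ?X = "{J. J \<subseteq> T - {a} \<and> indep adj J}" and ?Z = "{J. J \<subseteq> T \<inter> nonadj a \<and> indep adj J}"
  have eq: "{J. J \<subseteq> T \<and> indep adj J} = ?X \<union> insert a ` ?Z"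
  proof (intro equalityI subsetI)
    fix J assume J: "J \<in> {J. J \<subseteq> T \<and> indep adj J}"
    show "J \<in> ?X \<union> insert a ` ?Z"
    proof (cases "a \<in> J")
      case True
      then have "J = insert a (J - {a})" by auto
      moreover have "J - {a} \<in> ?Z"
        using J True by (auto simp: indep_def)
      ultimately show ?thesis by blast
    qed (use J in auto)
  next
    fix J assume "J \<in> ?X \<union> insert a ` ?Z"
    then show "J \<in> {J. J \<subseteq> T \<and> indep adj J}"
      using assms by (auto simp: indep_def dest: adj_sym)
  qed
  have notin: "a \<notin> J" if "J \<in> ?Z" for J
    using that adj_refl by auto
  have inj: "inj_on (insert a) ?Z"
    using notin by (meson inj_onI insert_ident)
  have fin: "finite ?X" "finite ?Z"
    using assms by auto
  have "Y T = (\<Sum>J\<in>?X. \<Prod>j\<in>J. \<mu> j) + (\<Sum>J\<in>insert a ` ?Z. \<Prod>j\<in>J. \<mu> j)"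
    unfolding indep_poly_def eq using fin by (intro sum.union_disjoint) auto
  also have "(\<Sum>J\<in>insert a ` ?Z. \<Prod>j\<in>J. \<mu> j) = (\<Sum>J\<in>?Z. \<mu> a * (\<Prod>j\<in>J. \<mu> j))"
  proof -
    have "(\<Prod>j\<in>insert a J. \<mu> j) = \<mu> a * (\<Prod>j\<in>J. \<mu> j)" if "J \<in> ?Z" for J
      using notin[OF that] that assms(1) by (intro prod.insert) (auto intro: finite_subset)
    then show ?thesis
      unfolding sum.reindex[OF inj] comp_def by (intro sum.cong refl)
  qed
  finally show ?thesis
    by (simp add: indep_poly_def sum_distrib_left)
qed

text \<open>Induction on \<open>B\<close>: \<open>Y_rec\<close> at some \<open>a\<close> in
  \<open>B\<close> splits both sides. \<open>A\<close> varies because the second term replaces it by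
  \<open>A \<inter> nonadj a\<close>.\<close>

lemma Y_Un_le:
  assumes "finite A" "finite B"
  shows "Y (A \<union> B) \<le> Y A * Y B"
  using assms(2,1)
proof (induction B arbitrary: A rule: finite_psubset_induct)
  case (psubset B)
  show ?case
  proof (cases "B = {}")
    case False
    then obtain a where a: "a \<in> B" by blast
    have YA: "Y A \<ge> 0" using Y_ge_1[OF psubset.prems] by simp
    have IH: "Y (A \<union> (B - {a})) \<le> Y A * Y (B - {a})"
      using a psubset by blast
    show ?thesis
    proof (cases "a \<in> A")
      case True
      then have "A \<union> B = A \<union> (B - {a})" by auto
      then have "Y (A \<union> B) \<le> Y A * Y (B - {a})"
        using IH by simp
      also have "\<dots> \<le> Y A * Y B"
        using YA psubset.hyps by (intro mult_left_mono Y_mono) auto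
      finally show ?thesis .
    next
      case False
      have "B \<inter> nonadj a \<subset> B" using a adj_refl by auto
      then have "Y ((A \<inter> nonadj a) \<union> (B \<inter> nonadj a)) \<le> Y (A \<inter> nonadj a) * Y (B \<inter> nonadj a)"
        using psubset by simp
      also have "\<dots> \<le> Y A * Y (B \<inter> nonadj a)"
        using psubset.prems psubset.hyps Y_ge_1[of "B \<inter> nonadj a"]
        by (intro mult_right_mono Y_mono) auto
      finally have 1: "Y ((A \<union> B) \<inter> nonadj a) \<le> Y A * Y (B \<inter> nonadj a)"
        by (simp add: Int_Un_distrib2)
      have "Y (A \<union> B) = Y (A \<union> B - {a}) + \<mu> a * Y ((A \<union> B) \<inter> nonadj a)"
        using a psubset by (intro Y_rec) auto
      also have "A \<union> B - {a} = A \<union> (B - {a})" using False by auto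
      also have "Y (A \<union> (B - {a})) + \<mu> a * Y ((A \<union> B) \<inter> nonadj a)
          \<le> Y A * Y (B - {a}) + \<mu> a * (Y A * Y (B \<inter> nonadj a))"
        by (intro add_mono IH mult_left_mono 1 weight_nonneg)
      also have "\<dots> = Y A * Y B"
        using Y_rec[OF psubset.hyps a] by (simp add: algebra_simps)
      finally show ?thesis .
    qed
  qed simp
qed

text \<open>Two distinct members of a clique are never independent, so only the empty set and the
  singletons contribute.\<close>

lemma Y_clique_le:
  assumes "finite C" "\<And>a b. a \<in> C \<Longrightarrow> b \<in> C \<Longrightarrow> adj a b"
  shows "Y C \<le> 1 + sum \<mu> C"
  using assms
proof (induction C rule: finite_induct)
  case (insert a C)
  have "insert a C \<inter> nonadj a = {}" using insert.prems by auto
  then have "Y (insert a C) = Y (insert a C - {a}) + \<mu> a"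
    using Y_rec[of "insert a C" a] insert.hyps by simp
  then show ?case using insert by simp
qed simp

text \<open>Turns a cover of a neighbourhood by cliques, possibly overlapping, into the bound that
  enters the local lemma criterion.\<close>

lemma Y_cliques_le:
  assumes "finite K" "\<And>i. i \<in> K \<Longrightarrow> finite (C i)"
    and "\<And>i a b. i \<in> K \<Longrightarrow> a \<in> C i \<Longrightarrow> b \<in> C i \<Longrightarrow> adj a b"
    and "\<And>i. i \<in> K \<Longrightarrow> sum \<mu> (C i) \<le> s"
  shows "Y (\<Union>i\<in>K. C i) \<le> (1 + s) ^ card K"
  using assms
proof (induction K rule: finite_induct)
  case (insert i K)
  have fin: "finite (C i)" "finite (\<Union>i\<in>K. C i)" using insert by auto
  have "Y (\<Union>i\<in>insert i K. C i) \<le> Y (C i) * Y (\<Union>i\<in>K. C i)"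
    using Y_Un_le[OF fin] by simp
  also have "\<dots> \<le> (1 + s) * (1 + s) ^ card K"
  proof (intro mult_mono)
    have "Y (C i) \<le> 1 + sum \<mu> (C i)"
      using insert.prems by (intro Y_clique_le) auto
    also have "\<dots> \<le> 1 + s" using insert.prems by simp
    finally show le: "Y (C i) \<le> 1 + s" .
    show "0 \<le> 1 + s" using le Y_ge_1[OF fin(1)] by simp
    show "Y (\<Union>i\<in>K. C i) \<le> (1 + s) ^ card K"
      by (rule insert.IH) (use insert.prems in auto)
    show "0 \<le> Y (\<Union>i\<in>K. C i)" using Y_ge_1[OF fin(2)] by simp
  qed
  finally show ?case using insert.hyps by simp
qed simp

section \<open>The local lemma in cluster expansion form\<close>

text \<open>Probabilities are replaced by counting in the finite sample space \<open>\<Omega>\<close>.\<close>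

theorem cluster_expansion_local_lemma:
  fixes A :: "'i \<Rightarrow> 'w set"
  assumes "finite I" "finite \<Omega>" "\<Omega> \<noteq> {}" and p_nonneg: "\<And>a. p a \<ge> 0"
    and lopsided: "\<And>a S. a \<in> I \<Longrightarrow> S \<subseteq> I \<Longrightarrow> (\<And>b. b \<in> S \<Longrightarrow> \<not> adj a b) \<Longrightarrow>
      real (card ((\<Omega> - (\<Union>b\<in>S. A b)) \<inter> A a)) \<le> p a * real (card (\<Omega> - (\<Union>b\<in>S. A b)))"
    and cluster: "\<And>a. a \<in> I \<Longrightarrow> p a * Y {b \<in> I. adj a b} \<le> \<mu> a"
  shows "\<Omega> - (\<Union>a\<in>I. A a) \<noteq> {}"
proof -
  \<comment> \<open>Divided by \<open>card \<Omega>\<close>, this is the probability that no event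
    of \<open>S\<close> occurs. Products replace quotients below, as \<open>P\<close> is not yet
    known to be positive.\<close>
  define P where "P S = real (card (\<Omega> - (\<Union>b\<in>S. A b)))" for S
  have pos: "Y T > 0" if "T \<subseteq> I" for T
    using Y_ge_1[of T] finite_subset[OF that \<open>finite I\<close>] by simp
  have fin: "finite T" if "T \<subseteq> I" for T
    using finite_subset[OF that \<open>finite I\<close>] .
  \<comment> \<open>The ratio bound is stated for all subsets \<open>S'\<close> at once: extending \<open>U\<close> by \<open>a\<close> uses it for
    \<open>U \<inter> nonadj a\<close> in place of \<open>S'\<close>.\<close>
  have main: "S' \<subseteq> S \<Longrightarrow> P S' * Y (I - S) \<le> P S * Y (I - S')" if "finite S" "S \<subseteq> I" for S S'
    using that
  proof (induction S arbitrary: S' rule: finite_psubset_induct)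
    case (psubset S)
    show ?case
    proof (cases "S' = S")
      case False
      then obtain a where a: "a \<in> S" "a \<notin> S'" using psubset.prems by blast
      \<comment> \<open>One event at a time: it is enough to compare \<open>P U\<close> with
        \<open>P S\<close> and then to chain this with the induction hypothesis from
        \<open>S'\<close> to \<open>U\<close>.\<close>
      define U where "U = S - {a}"
      have U: "U \<subset> S" "U \<subseteq> I" "a \<notin> U" "S = insert a U" "a \<in> I" "S' \<subseteq> U"
        using a psubset.prems by (auto simp: U_def)
      have IH: "P W * Y (I - U) \<le> P U * Y (I - W)" if "W \<subseteq> U" for W
        using psubset.IH[OF U(1) that U(2)] .
      define W where "W = U \<inter> nonadj a"
      have W: "W \<subseteq> U" by (auto simp: W_def)
      have "P U - P S = real (card ((\<Omega> - (\<Union>b\<in>U. A b)) \<inter> A a))"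
      proof -
        have "\<Omega> - (\<Union>b\<in>S. A b) = (\<Omega> - (\<Union>b\<in>U. A b)) - (\<Omega> - (\<Union>b\<in>U. A b)) \<inter> A a"
          by (auto simp: U(4))
        then have "P S = real (card (\<Omega> - (\<Union>b\<in>U. A b))) - real (card ((\<Omega> - (\<Union>b\<in>U. A b)) \<inter> A a))"
          unfolding P_def using \<open>finite \<Omega>\<close>
          by (metis (no_types, lifting) Int_lower1 card_Diff_subset card_mono finite_Diff finite_Int of_nat_diff)
        then show ?thesis by (simp add: P_def)
      qed
      \<comment> \<open>Forgetting the events of \<open>U\<close> adjacent to \<open>a\<close> only
        enlarges the set; lopsidedness then applies to the remaining events
        \<open>W\<close>.\<close>
      also have "\<dots> \<le> real (card ((\<Omega> - (\<Union>b\<in>W. A b)) \<inter> A a))"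
        using \<open>finite \<Omega>\<close> W by (intro of_nat_mono card_mono) auto
      also have "\<dots> \<le> p a * P W"
        unfolding P_def using U W by (intro lopsided) (auto simp: W_def)
      finally have 1: "P U - P S \<le> p a * P W" .
      have "P W * Y (I - U) \<le> P U * Y (I - W)" by (rule IH[OF W])
      \<comment> \<open>An index outside \<open>W\<close> is either a neighbour of \<open>a\<close>
        or a non-neighbour outside \<open>U\<close>.\<close>
      also have "Y (I - W) \<le> Y ({b \<in> I. adj a b} \<union> (I - U) \<inter> nonadj a)"
        using \<open>finite I\<close> by (intro Y_mono) (auto simp: W_def)
      also have "\<dots> \<le> Y {b \<in> I. adj a b} * Y ((I - U) \<inter> nonadj a)"
        using \<open>finite I\<close> by (intro Y_Un_le) auto
      finally have 2: "P W * Y (I - U) \<le> P U * (Y {b \<in> I. adj a b} * Y ((I - U) \<inter> nonadj a))"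
        by (simp add: P_def mult_left_mono)
      have "(P U - P S) * Y (I - U) \<le> p a * (P W * Y (I - U))"
        using mult_right_mono[OF 1, of "Y (I - U)"] pos[of "I - U"] by (simp add: mult_ac)
      also have "\<dots> \<le> p a * (P U * (Y {b \<in> I. adj a b} * Y ((I - U) \<inter> nonadj a)))"
        using 2 p_nonneg by (intro mult_left_mono)
      also have "\<dots> = p a * Y {b \<in> I. adj a b} * (P U * Y ((I - U) \<inter> nonadj a))"
        by (simp add: mult_ac)
      also have "\<dots> \<le> \<mu> a * (P U * Y ((I - U) \<inter> nonadj a))"
      proof (intro mult_right_mono cluster U(5))
        have "Y ((I - U) \<inter> nonadj a) > 0" by (intro pos) auto
        then show "0 \<le> P U * Y ((I - U) \<inter> nonadj a)" by (simp add: P_def)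
      qed
      \<comment> \<open>This is the recursion of \<open>Y\<close> at \<open>a\<close> on
        \<open>I - U\<close>, solved for the term with \<open>\<mu> a\<close>.\<close>
      also have "\<dots> = P U * (Y (I - U) - Y (I - S))"
      proof -
        have "I - U - {a} = I - S" by (auto simp: U(4))
        then show ?thesis
          using Y_rec[of "I - U" a] \<open>finite I\<close> U by simp
      qed
      finally have step: "P U * Y (I - S) \<le> P S * Y (I - U)"
        by (simp add: algebra_simps)
      have "(P S' * Y (I - S)) * Y (I - U) = (P S' * Y (I - U)) * Y (I - S)"
        by (simp add: mult_ac)
      also have "\<dots> \<le> (P U * Y (I - S')) * Y (I - S)"
        using IH[OF U(6)] pos[of "I - S"] by (intro mult_right_mono) auto
      also have "\<dots> = (P U * Y (I - S)) * Y (I - S')" by (simp add: mult_ac)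
      also have "\<dots> \<le> (P S * Y (I - U)) * Y (I - S')"
        using step pos[of "I - S'"] by (intro mult_right_mono) auto
      finally have "(P S' * Y (I - S)) * Y (I - U) \<le> (P S * Y (I - S')) * Y (I - U)"
        by (simp add: mult_ac)
      then show ?thesis using pos[of "I - U"] by (simp add: mult_le_cancel_right)
    qed simp
  qed
  \<comment> \<open>Comparing no events with all events gives \<open>P {} \<le> P I * Y I\<close>,
    which forces \<open>P I\<close> to be positive.\<close>
  have "P {} * Y (I - I) \<le> P I * Y (I - {})"
    by (rule main) (use \<open>finite I\<close> in auto)
  moreover have "P {} > 0"
    using assms(2,3) by (simp add: P_def card_gt_0_iff)
  ultimately have "P I > 0"
    using pos[of I] by (simp add: zero_less_mult_iff) (smt (verit) mult_nonpos_nonneg)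
  then have "card (\<Omega> - (\<Union>a\<in>I. A a)) \<noteq> 0" by (simp add: P_def)
  then show ?thesis by (metis card.empty)
qed

end

section \<open>Lopsidedness of random injections\<close>

text \<open>Moving the placement \<open>f\<close> to the placement \<open>g\<close> displaces the
  points that lie only in the image of \<open>g\<close>; they refill the places vacated by
  \<open>f\<close>, and all further points stay. A point outside the image of \<open>f\<close> is
  thus fixed or lands in that image, which is what protects events disjoint from
  \<open>f\<close>.\<close>

lemma exchange_map:
  assumes "finite B" "inj_on f X" "inj_on g X" "f ` X \<subseteq> B" "g ` X \<subseteq> B"
  obtains \<pi> where "inj_on \<pi> B" "\<pi> ` B \<subseteq> B" "\<And>x. x \<in> X \<Longrightarrow> \<pi> (f x) = g x"
    "\<And>b. b \<in> B \<Longrightarrow> b \<notin> f ` X \<Longrightarrow> \<pi> b = b \<or> \<pi> b \<in> f ` X"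
proof -
  define F where "F = f ` X"
  define C where "C = g ` X"
  have finFC: "finite F" "finite C"
    using assms by (auto simp: F_def C_def intro: finite_subset)
  have "card F = card C"
    using assms by (simp add: F_def C_def card_image)
  \<comment> \<open>The two images have the same size, hence so do their differences, and
    \<open>h\<close> matches these.\<close>
  then have "card (C - F) = card (F - C)"
    using finFC by (metis card_le_sym_Diff le_antisym order_refl)
  then obtain h where h: "bij_betw h (C - F) (F - C)"
    using finFC finite_same_card_bij[of "C - F" "F - C"] by auto
  have g: "bij_betw (g \<circ> inv_into X f) F C"
    unfolding F_def C_def
    by (intro bij_betw_trans[of _ _ X] bij_betw_inv_into)
       (use assms in \<open>auto intro: inj_on_imp_bij_betw\<close>)
  define \<pi> where "\<pi> b = (if b \<in> F then (g \<circ> inv_into X f) b else if b \<in> C then h b else b)" for b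
  have 1: "bij_betw \<pi> F C"
    using g by (subst bij_betw_cong[of F \<pi> "g \<circ> inv_into X f"]) (auto simp: \<pi>_def)
  have 2: "bij_betw \<pi> (C - F) (F - C)"
    using h by (subst bij_betw_cong[of "C - F" \<pi> h]) (auto simp: \<pi>_def)
  have 3: "bij_betw \<pi> (B - (F \<union> C)) (B - (F \<union> C))"
    by (subst bij_betw_cong[of _ \<pi> id]) (auto simp: \<pi>_def)
  have "bij_betw \<pi> (F \<union> (C - F) \<union> (B - (F \<union> C))) (C \<union> (F - C) \<union> (B - (F \<union> C)))"
    by (intro bij_betw_combine 1 2 3) auto
  moreover have "F \<union> (C - F) \<union> (B - (F \<union> C)) = B" "C \<union> (F - C) \<union> (B - (F \<union> C)) = B"
    using assms by (auto simp: F_def C_def)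
  ultimately have bij: "bij_betw \<pi> B B" by simp
  show ?thesis
  proof (rule that[of \<pi>])
    show "inj_on \<pi> B" "\<pi> ` B \<subseteq> B"
      using bij by (auto simp: bij_betw_def)
    show "\<pi> (f x) = g x" if "x \<in> X" for x
      using that assms(2) by (simp add: \<pi>_def F_def)
    show "\<pi> b = b \<or> \<pi> b \<in> f ` X" if "b \<in> B" "b \<notin> f ` X" for b
      using that 2 by (auto simp: \<pi>_def F_def bij_betw_def)
  qed
qed

text \<open>Partial assignments are sets of pairs, so the vertices and the values that an event
  involves are its images under \<open>fst\<close> and \<open>snd\<close>.\<close>

definition extends :: "('a \<times> 'b) set \<Rightarrow> ('a \<Rightarrow> 'b) set" where
  "extends R = {\<sigma>. \<forall>(x, u) \<in> R. \<sigma> x = u}"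

text \<open>For every injection \<open>g\<close> of the domain of \<open>R\<close> into
  \<open>B\<close>, an exchange maps the avoiding injections that extend \<open>R\<close> one-to-one
  to avoiding injections that extend \<open>g\<close>. These classes are disjoint, and the number of
  choices of \<open>g\<close> is the falling factorial in the statement.\<close>

lemma card_injections_lopsided:
  fixes X :: "'a set" and B :: "'b set"
    and R :: "('a \<times> 'b) set" and \<S> :: "('a \<times> 'b) set set"
  defines "avoid \<equiv> {\<sigma> \<in> X \<rightarrow>\<^sub>E B. inj_on \<sigma> X} - (\<Union>Q\<in>\<S>. extends Q)"
  assumes "finite X" "finite B" "R \<subseteq> X \<times> B" "inj_on fst R" "inj_on snd R"
    and dom: "\<And>Q. Q \<in> \<S> \<Longrightarrow> Q \<subseteq> X \<times> B"
    and disj: "\<And>Q. Q \<in> \<S> \<Longrightarrow> fst ` R \<inter> fst ` Q = {} \<and> snd ` R \<inter> snd ` Q = {}"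
  shows "card (avoid \<inter> extends R) * (\<Prod>i<card R. card B - i) \<le> card avoid"
proof -
  \<comment> \<open>\<open>f\<close> is \<open>R\<close> as a function on its domain
    \<open>D\<close>; \<open>J\<close> consists of its possible replacements.\<close>
  define D where "D = fst ` R"
  define f where "f = snd \<circ> inv_into R fst"
  define J where "J = {g \<in> D \<rightarrow>\<^sub>E B. inj_on g D}"
  have D: "D \<subseteq> X" using assms(4) by (auto simp: D_def)
  then have finD: "finite D" using assms(2) by (rule finite_subset)
  have f: "f x = u" if "(x, u) \<in> R" for x u
    using inv_into_f_f[OF assms(5) that] by (simp add: f_def)
  have fD: "f ` D = snd ` R"
    by (force simp: D_def f image_iff)
  then have fB: "f ` D \<subseteq> B" using assms(4) by auto
  have inj_f: "inj_on f D"
    using assms(6) unfolding D_def by (force simp: inj_on_def f)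
  have ext_f: "\<sigma> \<in> extends R \<longleftrightarrow> (\<forall>x\<in>D. \<sigma> x = f x)" for \<sigma>
    by (auto simp: extends_def D_def f)
  have avoid_iff: "\<sigma> \<in> avoid \<longleftrightarrow> \<sigma> \<in> X \<rightarrow>\<^sub>E B \<and> inj_on \<sigma> X \<and> (\<forall>Q\<in>\<S>. \<sigma> \<notin> extends Q)" for \<sigma>
    by (simp add: avoid_def)
  have finJ: "finite J"
    unfolding J_def using finD assms(3) by (simp add: finite_PiE)
  have fin: "finite avoid"
    unfolding avoid_def using assms(2,3) by (simp add: finite_PiE)
  have "card J = (\<Prod>i<card R. card B - i)"
    using card_inj_on_subset_funcset[of D B D] finD assms(3,5)
    by (simp add: J_def D_def card_image lessThan_atLeast0)
  then have "card (avoid \<inter> extends R) * (\<Prod>i<card R. card B - i)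
      = (\<Sum>g\<in>J. card (avoid \<inter> extends R))" by simp
  also have "\<dots> \<le> (\<Sum>g\<in>J. card {\<sigma> \<in> avoid. \<forall>x\<in>D. \<sigma> x = g x})"
  proof (intro sum_mono)
    fix g assume g: "g \<in> J"
    have gD: "inj_on g D" "g ` D \<subseteq> B" using g by (auto simp: J_def)
    obtain \<pi> where \<pi>: "inj_on \<pi> B" "\<pi> ` B \<subseteq> B" "\<And>x. x \<in> D \<Longrightarrow> \<pi> (f x) = g x"
      "\<And>b. b \<in> B \<Longrightarrow> b \<notin> f ` D \<Longrightarrow> \<pi> b = b \<or> \<pi> b \<in> f ` D"
      using exchange_map[OF assms(3) inj_f gD(1) fB gD(2)] by metis
    \<comment> \<open>Composing with \<open>\<pi>\<close> creates no new bad event: every other vertex whose image changes is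
      sent into the range of \<open>R\<close>, which the events in \<open>\<S>\<close> do not meet.\<close>
    let ?t = "\<lambda>\<sigma>. restrict (\<pi> \<circ> \<sigma>) X"
    show "card (avoid \<inter> extends R) \<le> card {\<sigma> \<in> avoid. \<forall>x\<in>D. \<sigma> x = g x}"
    proof (rule card_inj_on_le[of ?t])
      show "inj_on ?t (avoid \<inter> extends R)"
      proof (rule inj_onI)
        fix \<sigma> \<tau> assume st: "\<sigma> \<in> avoid \<inter> extends R" "\<tau> \<in> avoid \<inter> extends R" "?t \<sigma> = ?t \<tau>"
        show "\<sigma> = \<tau>"
        proof (rule PiE_ext[of _ X "\<lambda>_. B"])
          fix x assume x: "x \<in> X"
          then have "\<pi> (\<sigma> x) = \<pi> (\<tau> x)" using st(3) by (metis comp_apply restrict_apply')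
          moreover have "\<sigma> x \<in> B" "\<tau> x \<in> B"
            using st(1,2) x by (auto simp: avoid_iff)
          ultimately show "\<sigma> x = \<tau> x"
            using \<pi>(1) by (simp add: inj_on_eq_iff)
        qed (use st(1,2) in \<open>simp_all add: avoid_iff\<close>)
      qed
      show "?t ` (avoid \<inter> extends R) \<subseteq> {\<sigma> \<in> avoid. \<forall>x\<in>D. \<sigma> x = g x}"
      proof safe
        fix \<sigma> assume s: "\<sigma> \<in> avoid" "\<sigma> \<in> extends R"
        have sB: "\<sigma> x \<in> B" if "x \<in> X" for x
          using s(1) that by (auto simp: avoid_iff)
        have inj_s: "inj_on \<sigma> X" using s(1) by (simp add: avoid_iff)
        have inj: "inj_on (\<pi> \<circ> \<sigma>) X"
          using sB by (intro comp_inj_on[OF inj_s] inj_on_subset[OF \<pi>(1)]) auto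
        show "?t \<sigma> x = g x" if "x \<in> D" for x
          using that s(2) subsetD[OF D that] \<pi>(3)[OF that] by (simp add: ext_f)
        have "?t \<sigma> \<notin> extends Q" if Q: "Q \<in> \<S>" for Q
        proof
          assume tQ: "?t \<sigma> \<in> extends Q"
          have "\<sigma> x = u" if xu: "(x, u) \<in> Q" for x u
          proof -
            have "x \<in> fst ` Q" "u \<in> snd ` Q" using xu by force+
            then have x: "x \<in> X" "x \<notin> D" "u \<notin> f ` D"
              using dom[OF Q] disj[OF Q] xu unfolding D_def fD[unfolded D_def] by blast+
            have u: "\<pi> (\<sigma> x) = u"
              using tQ xu x(1) by (auto simp: extends_def)
            \<comment> \<open>Injectivity of \<open>\<sigma>\<close> keeps \<open>\<sigma> x\<close>
              away from the values used on \<open>D\<close>. So \<open>\<pi>\<close> fixes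
              \<open>\<sigma> x\<close> or moves it into the range of \<open>f\<close>, and the
              latter does not contain \<open>u\<close>.\<close>
            have "\<sigma> x \<notin> f ` D"
            proof
              assume "\<sigma> x \<in> f ` D"
              then obtain y where y: "y \<in> D" "\<sigma> x = f y" by auto
              then have "\<sigma> x = \<sigma> y" using s(2) by (simp add: ext_f)
              then show False using inj_onD[OF inj_s] x(1,2) y(1) D by blast
            qed
            then show ?thesis using \<pi>(4)[OF sB[OF x(1)]] x(3) u by metis
          qed
          then have "\<sigma> \<in> extends Q" by (auto simp: extends_def)
          then show False using s(1) Q by (simp add: avoid_iff)
        qed
        then show "?t \<sigma> \<in> avoid"
          unfolding avoid_iff using inj sB \<pi>(2) by (auto simp: inj_on_def)
      qed
    qed (use fin in auto)
  qed
  also have "\<dots> = card (\<Union>g\<in>J. {\<sigma> \<in> avoid. \<forall>x\<in>D. \<sigma> x = g x})"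
  proof (rule card_UN_disjoint[symmetric])
    show "\<forall>g\<in>J. \<forall>h\<in>J. g \<noteq> h \<longrightarrow>
        {\<sigma> \<in> avoid. \<forall>x\<in>D. \<sigma> x = g x} \<inter> {\<sigma> \<in> avoid. \<forall>x\<in>D. \<sigma> x = h x} = {}"
    proof (intro ballI impI equals0I)
      fix g h \<sigma> assume gh: "g \<in> J" "h \<in> J" "g \<noteq> h"
        "\<sigma> \<in> {\<sigma> \<in> avoid. \<forall>x\<in>D. \<sigma> x = g x} \<inter> {\<sigma> \<in> avoid. \<forall>x\<in>D. \<sigma> x = h x}"
      have "g = h"
        by (rule PiE_ext[of _ D "\<lambda>_. B"]) (use gh in \<open>auto simp: J_def\<close>)
      then show False using gh by simp
    qed
  qed (use finJ fin in auto)
  also have "\<dots> \<le> card avoid"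
    using fin by (intro card_mono) auto
  finally show ?thesis .
qed

section \<open>Counting cherries and events\<close>

text \<open>Every fibre over the image contains some \<open>t\<close> and the different element
  \<open>h t\<close>.\<close>

lemma double_card_image_le:
  assumes "finite T" "\<And>t. t \<in> T \<Longrightarrow> h t \<in> T \<and> h t \<noteq> t \<and> f (h t) = f t"
  shows "2 * card (f ` T) \<le> card T"
proof -
  have "2 * card (f ` T) = (\<Sum>r\<in>f ` T. 2)" by simp
  also have "\<dots> \<le> (\<Sum>r\<in>f ` T. card {t \<in> T. f t = r})"
  proof (rule sum_mono)
    fix r assume "r \<in> f ` T"
    then obtain t where t: "t \<in> T" "r = f t" by auto
    then have "card {t, h t} \<le> card {t \<in> T. f t = r}"
      using assms by (intro card_mono) auto
    then show "2 \<le> card {t \<in> T. f t = r}"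
      using assms(2)[OF t(1)] by (auto simp: card_insert_if split: if_splits)
  qed
  also have "\<dots> = (\<Sum>r\<in>f ` T. \<Sum>t | t \<in> T \<and> f t = r. 1)" by simp
  also have "\<dots> = card T"
    using sum.image_gen[OF assms(1), of "\<lambda>_. 1::nat" f] by simp
  finally show ?thesis .
qed

lemma card_Sigma_le:
  assumes "finite A" "\<And>a. a \<in> A \<Longrightarrow> finite (B a)" "\<And>a. a \<in> A \<Longrightarrow> real (card (B a)) \<le> k"
  shows "real (card (Sigma A B)) \<le> real (card A) * k"
proof -
  have "real (card (Sigma A B)) = (\<Sum>a\<in>A. real (card (B a)))"
    using assms by simp
  also have "\<dots> \<le> real (card A) * k"
    using assms by (intro sum_bounded_above)
  finally show ?thesis .
qed

fun points :: "'a \<times> 'a \<times> 'a \<Rightarrow> 'a set" where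
  "points (x, y, z) = {x, y, z}"

fun reversed :: "'a \<times> 'a \<times> 'a \<Rightarrow> 'a \<times> 'a \<times> 'a" where
  "reversed (x, y, z) = (z, y, x)"

text \<open>A set rather than a triple of pairs, so that reversing both paths gives the same
  event.\<close>

fun paired :: "('a \<times> 'a \<times> 'a) \<times> ('b \<times> 'b \<times> 'b) \<Rightarrow> ('a \<times> 'b) set" where
  "paired ((x, y, z), (u, v, w)) = {(x, u), (y, v), (z, w)}"

text \<open>A cherry is a path with two edges, listed in both directions with its centre in the middle.\<close>

locale cherry_system =
  fixes W :: "'a set" and d :: real and T :: "('a \<times> 'a \<times> 'a) set"
  assumes finite_W: "finite W"
    and cherryD: "(x, y, z) \<in> T \<Longrightarrow> x \<in> W \<and> y \<in> W \<and> z \<in> W \<and> x \<noteq> y \<and> y \<noteq> z \<and> x \<noteq> z"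
    and cherry_rev: "(x, y, z) \<in> T \<Longrightarrow> (z, y, x) \<in> T"
    and card_end: "x \<in> W \<Longrightarrow> real (card {(y, z). (x, y, z) \<in> T}) \<le> d"
    and card_centre: "y \<in> W \<Longrightarrow> real (card {(x, z). (x, y, z) \<in> T}) \<le> d"
begin

lemma finite_T: "finite T"
  by (rule finite_subset[of _ "W \<times> W \<times> W"]) (use finite_W in \<open>auto dest: cherryD\<close>)

lemma finite_end: "finite {(y, z). (x, y, z) \<in> T}"
  by (rule finite_subset[of _ "W \<times> W"]) (use finite_W in \<open>auto dest: cherryD\<close>)

lemma finite_centre: "finite {(x, z). (x, y, z) \<in> T}"
  by (rule finite_subset[of _ "W \<times> W"]) (use finite_W in \<open>auto dest: cherryD\<close>)

lemma card_T_le: "real (card T) \<le> real (card W) * d"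
proof -
  have "T = Sigma W (\<lambda>x. {(y, z). (x, y, z) \<in> T})"
    by (auto dest: cherryD)
  then have "card T = card (Sigma W (\<lambda>x. {(y, z). (x, y, z) \<in> T}))"
    by (rule arg_cong)
  then show ?thesis
    using card_Sigma_le[OF finite_W finite_end card_end] by simp
qed

text \<open>The vertex \<open>a\<close> is the first vertex, the centre or the last vertex, and
  reversal reduces the last case to the first.\<close>

lemma card_through_le:
  assumes "a \<in> W"
  shows "real (card {t \<in> T. a \<in> points t}) \<le> 3 * d"
proof -
  let ?E = "{(y, z). (a, y, z) \<in> T}" and ?C = "{(x, z). (x, a, z) \<in> T}"
  let ?f = "\<lambda>(y, z). (a, y, z)" and ?g = "\<lambda>(x, z). (x, a, z)" and ?h = "\<lambda>(y, x). (x, y, a)"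
  have "{t \<in> T. a \<in> points t} \<subseteq> ?f ` ?E \<union> (?g ` ?C \<union> ?h ` ?E)"
    using cherry_rev by (force simp: image_iff)
  then have "card {t \<in> T. a \<in> points t} \<le> card (?f ` ?E \<union> (?g ` ?C \<union> ?h ` ?E))"
    using finite_end finite_centre by (intro card_mono) auto
  also have "\<dots> \<le> card (?f ` ?E) + (card (?g ` ?C) + card (?h ` ?E))"
    by (meson add_left_mono card_Un_le le_trans)
  also have "\<dots> \<le> card ?E + (card ?C + card ?E)"
    using finite_end finite_centre by (intro add_mono card_image_le)
  finally show ?thesis
    using card_end[OF assms] card_centre[OF assms] by linarith
qed

end

lemma reversed_reversed [simp]: "reversed (reversed t) = t"
  by (cases t) auto

lemma points_reversed [simp]: "points (reversed t) = points t"
  by (cases t) auto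

lemma fst_paired [simp]: "fst ` paired (s, t) = points s"
  by (cases s; cases t) auto

lemma snd_paired [simp]: "snd ` paired (s, t) = points t"
  by (cases s; cases t) auto

lemma paired_reversed [simp]: "paired (reversed s, reversed t) = paired (s, t)"
  by (cases s; cases t) auto

text \<open>A pair of paths and its reversal describe the same event, whence the factor 2.\<close>

lemma card_paired_le:
  assumes "finite S" "finite T"
    and "\<And>s. s \<in> S \<Longrightarrow> reversed s \<in> S \<and> reversed s \<noteq> s"
    and "\<And>t. t \<in> T \<Longrightarrow> reversed t \<in> T"
    and "real (card S) \<le> a" "real (card T) \<le> b" "a \<ge> 0"
  shows "2 * real (card (paired ` (S \<times> T))) \<le> a * b"
proof -
  have "2 * card (paired ` (S \<times> T)) \<le> card (S \<times> T)"
    by (rule double_card_image_le[of _ "map_prod reversed reversed"]) (use assms in auto)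
  then have "2 * real (card (paired ` (S \<times> T))) \<le> real (card S) * real (card T)"
    by (simp add: card_cartesian_product flip: of_nat_mult)
  also have "\<dots> \<le> a * b"
    using assms by (intro mult_mono) auto
  finally show ?thesis .
qed

section \<open>The local lemma applied to cherries\<close>

text \<open>Only the cherry counts matter, so graphs and colours are abstracted away:
  \<open>S\<close> stands for the cherries of \<open>G\<close>, with \<open>d\<close> the squared
  maximum degree, and \<open>T\<close> for the monochromatic cherries of the complete graph, with
  \<open>e = (n - 1) * k\<close>.\<close>

theorem cherry_avoiding_injection:
  fixes S :: "('a \<times> 'a \<times> 'a) set" and T :: "('b \<times> 'b \<times> 'b) set"
  assumes "cherry_system V d S" "cherry_system B e T"
    and card: "card V = n" "card B = n"
    and bound: "22.4 * (d * e) \<le> (real n - 1) * (real n - 2)"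
  obtains \<sigma> where "inj_on \<sigma> V" "\<sigma> ` V \<subseteq> B" "\<And>x y z. (x, y, z) \<in> S \<Longrightarrow> (\<sigma> x, \<sigma> y, \<sigma> z) \<notin> T"
proof -
  interpret S: cherry_system V d S by fact
  interpret T: cherry_system B e T by fact
  define \<Omega> where "\<Omega> = {\<sigma> \<in> V \<rightarrow>\<^sub>E B. inj_on \<sigma> V}"
  define I where "I = paired ` (S \<times> T)"
  have fin_\<Omega>: "finite \<Omega>"
    using S.finite_W T.finite_W unfolding \<Omega>_def by (simp add: finite_PiE)
  obtain h where h: "bij_betw h V B"
    using finite_same_card_bij S.finite_W T.finite_W card by metis
  have "restrict h V \<in> \<Omega>"
    using h by (auto simp: \<Omega>_def bij_betw_def inj_on_def)
  then have \<Omega>_ne: "\<Omega> \<noteq> {}" by auto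
  have fin_I: "finite I"
    unfolding I_def using S.finite_T T.finite_T by auto
  have "\<Omega> - (\<Union>R\<in>I. extends R) \<noteq> {}"
  \<comment> \<open>If there is an event, it supplies three points and positive counts, which make
    the denominators below positive.\<close>
  proof (cases "I = {}")
    case False
    then obtain s t where st: "s \<in> S" "t \<in> T" by (auto simp: I_def)
    obtain u v w where "t = (u, v, w)" by (cases t)
    then have "card (points t) = 3" "points t \<subseteq> B"
      using T.cherryD st(2) by auto
    then have n: "n \<ge> 3"
      using card_mono[OF T.finite_W, of "points t"] card by simp
    have "card S \<noteq> 0" "card T \<noteq> 0"
      using st S.finite_T T.finite_T by auto
    then have "real n * d > 0" "real n * e > 0"
      using S.card_T_le T.card_T_le card by (smt (verit) of_nat_0_less_iff gr0I)+
    then have pos: "d > 0" "e > 0" using n by (auto simp: zero_less_mult_iff)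
    \<comment> \<open>At most \<open>3 * d\<close> cherries pass through a vertex of
      \<open>V\<close> and \<open>T\<close> has at most \<open>n * e\<close> cherries; half of the
      product remains after identifying reversals. Vertices of \<open>B\<close> give the same
      value.\<close>
    define N where "N = 3 / 2 * (real n * (d * e))"
    have N: "N > 0" using n pos by (simp add: N_def)
    \<comment> \<open>The disjunct \<open>R = Q\<close> makes the relation reflexive at the empty
      set as well.\<close>
    define adj where "adj R Q \<longleftrightarrow> R = Q \<or> fst ` R \<inter> fst ` Q \<noteq> {} \<or> snd ` R \<inter> snd ` Q \<noteq> {}"
      for R Q :: "('a \<times> 'b) set"
    \<comment> \<open>Each of the six cliques then has total weight at most \<open>1 / 5\<close>,
      the value of \<open>s\<close> that minimises \<open>(1 + s) ^ 6 / s\<close>.\<close>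
    interpret weighted_conflicts adj "\<lambda>_. 1 / (5 * N)"
      by unfold_locales (use N in \<open>auto simp: adj_def\<close>)
    have I_D: "R \<subseteq> V \<times> B \<and> inj_on fst R \<and> inj_on snd R \<and> card R = 3" if R: "R \<in> I" for R
    proof -
      obtain s t where st: "s \<in> S" "t \<in> T" "R = paired (s, t)"
        using R unfolding I_def by blast
      obtain x y z u v w where "s = (x, y, z)" "t = (u, v, w)"
        by (cases s, cases t)
      then show ?thesis
        using st S.cherryD[of x y z] T.cherryD[of u v w] by auto
    qed
    have S_rev: "reversed s \<in> S \<and> reversed s \<noteq> s" if "s \<in> S" for s
      using that S.cherry_rev S.cherryD by (cases s) auto
    have T_rev: "reversed t \<in> T" if "t \<in> T" for t
      using that T.cherry_rev by (cases t) auto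
    have clique_fst: "real (card {R \<in> I. x \<in> fst ` R}) \<le> N" if "x \<in> V" for x
    proof -
      have "{R \<in> I. x \<in> fst ` R} = paired ` ({s \<in> S. x \<in> points s} \<times> T)"
        unfolding I_def by force
      moreover have "2 * real (card (paired ` ({s \<in> S. x \<in> points s} \<times> T))) \<le> (3 * d) * (real n * e)"
        using S.finite_T T.finite_T S_rev T_rev S.card_through_le[OF that] T.card_T_le card pos
        by (intro card_paired_le) auto
      ultimately show ?thesis by (simp add: N_def algebra_simps)
    qed
    have clique_snd: "real (card {R \<in> I. u \<in> snd ` R}) \<le> N" if "u \<in> B" for u
    proof -
      have "{R \<in> I. u \<in> snd ` R} = paired ` (S \<times> {t \<in> T. u \<in> points t})"
        unfolding I_def by force
      moreover have "2 * real (card (paired ` (S \<times> {t \<in> T. u \<in> points t}))) \<le> (real n * d) * (3 * e)"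
        using S.finite_T T.finite_T S_rev T_rev T.card_through_le[OF that] S.card_T_le card pos
        by (intro card_paired_le) auto
      ultimately show ?thesis by (simp add: N_def algebra_simps)
    qed
    have falling: "(\<Prod>i<3. n - i) = n * (n - 1) * (n - 2)"
      using n by (simp add: numeral_2_eq_2 numeral_3_eq_3 lessThan_Suc mult_ac)
    define D where "D = real n * (real n - 1) * (real n - 2)"
    have D: "real (n * (n - 1) * (n - 2)) = D" "D > 0"
      using n by (auto simp: D_def of_nat_diff)
    show ?thesis
    proof (rule cluster_expansion_local_lemma[of _ _ "\<lambda>_. 1 / D"])
      show "finite I" "finite \<Omega>" "\<Omega> \<noteq> {}" "0 \<le> 1 / D"
        using fin_I fin_\<Omega> \<Omega>_ne D by auto
    next
      fix R \<S> assume R: "R \<in> I" "\<S> \<subseteq> I" "\<And>Q. Q \<in> \<S> \<Longrightarrow> \<not> adj R Q"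
      have "card ((\<Omega> - (\<Union>Q\<in>\<S>. extends Q)) \<inter> extends R) * (\<Prod>i<card R. card B - i)
          \<le> card (\<Omega> - (\<Union>Q\<in>\<S>. extends Q))"
        unfolding \<Omega>_def
      proof (rule card_injections_lopsided)
        show "finite V" "finite B" "R \<subseteq> V \<times> B" "inj_on fst R" "inj_on snd R"
          using S.finite_W T.finite_W I_D[OF R(1)] by auto
        show "Q \<subseteq> V \<times> B" if "Q \<in> \<S>" for Q
          using that R(2) I_D by blast
        show "fst ` R \<inter> fst ` Q = {} \<and> snd ` R \<inter> snd ` Q = {}" if "Q \<in> \<S>" for Q
          using R(3)[OF that] by (auto simp: adj_def)
      qed
      moreover have "(\<Prod>i<card R. card B - i) = n * (n - 1) * (n - 2)"
        using falling I_D[OF R(1)] card by simp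
      ultimately have "real (card ((\<Omega> - (\<Union>Q\<in>\<S>. extends Q)) \<inter> extends R)) * D
          \<le> real (card (\<Omega> - (\<Union>Q\<in>\<S>. extends Q)))"
        by (metis D(1) of_nat_le_iff of_nat_mult)
      then show "real (card ((\<Omega> - (\<Union>Q\<in>\<S>. extends Q)) \<inter> extends R))
          \<le> 1 / D * real (card (\<Omega> - (\<Union>Q\<in>\<S>. extends Q)))"
        using D(2) by (simp add: field_simps)
    next
      fix R assume R: "R \<in> I"
      \<comment> \<open>One clique for each vertex of \<open>R\<close> on either side; the sum type
        keeps the two kinds of vertices apart.\<close>
      define C where "C i = (case i of Inl x \<Rightarrow> {Q \<in> I. x \<in> fst ` Q} | Inr u \<Rightarrow> {Q \<in> I. u \<in> snd ` Q})"
        for i :: "'a + 'b"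
      \<comment> \<open>Having a vertex, \<open>R\<close> itself lies in one of the cliques, which
        settles the disjunct for equality in \<open>adj\<close>.\<close>
      have "R \<noteq> {}" using I_D[OF R] by auto
      then have cover: "{Q \<in> I. adj R Q} = (\<Union>i\<in>fst ` R <+> snd ` R. C i)"
        unfolding Plus_def by (auto simp: adj_def C_def)
      have fin_R: "finite R" using I_D[OF R] by (metis card.infinite zero_neq_numeral)
      have "card (fst ` R <+> snd ` R) = 6"
        using I_D[OF R] fin_R by (simp add: card_Plus card_image)
      moreover have "Y (\<Union>i\<in>fst ` R <+> snd ` R. C i) \<le> (1 + 1 / 5) ^ card (fst ` R <+> snd ` R)"
      proof (rule Y_cliques_le)
        show "finite (fst ` R <+> snd ` R)" using fin_R by auto
        show "finite (C i)" for i using fin_I by (auto simp: C_def split: sum.splits)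
        show "adj P Q" if "P \<in> C i" "Q \<in> C i" for i P Q
          using that by (auto simp: C_def adj_def split: sum.splits)
        show "(\<Sum>Q\<in>C i. 1 / (5 * N)) \<le> 1 / 5" if "i \<in> fst ` R <+> snd ` R" for i
        proof -
          have "real (card (C i)) \<le> N"
            using that clique_fst clique_snd I_D[OF R] by (auto simp: C_def)
          then show ?thesis using N by (simp add: field_simps)
        qed
      qed
      ultimately have Y_le: "Y {Q \<in> I. adj R Q} \<le> (6 / 5) ^ 6"
        unfolding cover by simp
      have "22.4 * (2 / 3 * N) = real n * (22.4 * (d * e))"
        by (simp add: N_def)
      also have "\<dots> \<le> D"
        unfolding D_def mult.assoc by (rule mult_left_mono[OF bound]) simp
      finally have N_le: "22.4 * (2 / 3 * N) \<le> D" .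
      have sixth_power: "(6 / 5) ^ 6 = (46656 / 15625 :: real)" by (simp add: power_divide)
      \<comment> \<open>Numerically, \<open>5 * (6 / 5) ^ 6 = 14.92992\<close> lies just below
        \<open>22.4 * 2 / 3\<close>, which is about 14.933.\<close>
      have "(6 / 5) ^ 6 * (5 * N) \<le> D"
        unfolding sixth_power using N N_le by linarith
      then have "(6 / 5) ^ 6 / D \<le> 1 / (5 * N)"
        using N D(2) by (simp only: divide_le_eq le_divide_eq times_divide_eq_left) simp
      moreover have "1 / D * Y {Q \<in> I. adj R Q} \<le> (6 / 5) ^ 6 / D"
        using divide_right_mono[OF Y_le less_imp_le[OF D(2)]] by simp
      ultimately show "1 / D * Y {Q \<in> I. adj R Q} \<le> 1 / (5 * N)"
        by linarith
    qed
  qed (use \<Omega>_ne in auto)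
  then obtain \<sigma> where \<sigma>: "\<sigma> \<in> \<Omega>" "\<And>R. R \<in> I \<Longrightarrow> \<sigma> \<notin> extends R" by blast
  show ?thesis
  proof (rule that[of \<sigma>])
    show "inj_on \<sigma> V" "\<sigma> ` V \<subseteq> B" using \<sigma>(1) by (auto simp: \<Omega>_def)
    fix x y z assume xyz: "(x, y, z) \<in> S"
    show "(\<sigma> x, \<sigma> y, \<sigma> z) \<notin> T"
    proof
      assume "(\<sigma> x, \<sigma> y, \<sigma> z) \<in> T"
      then have "paired ((x, y, z), (\<sigma> x, \<sigma> y, \<sigma> z)) \<in> I"
        using xyz unfolding I_def by blast
      from \<sigma>(2)[OF this] show False by (simp add: extends_def)
    qed
  qed
qed

section \<open>Cherries of a graph and monochromatic cherries\<close>

lemma card_neighbours: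
  assumes "finite_simple_graph G"
  shows "card {y. {x, y} \<in> eset G} = vertex_degree G x"
proof -
  have "bij_betw (\<lambda>y. {x, y}) {y. {x, y} \<in> eset G} {e \<in> eset G. x \<in> e}"
  proof (rule bij_betwI')
    fix e assume e: "e \<in> {e \<in> eset G. x \<in> e}"
    then have "card e = 2" using assms by (auto simp: finite_simple_graph_def)
    then obtain a b where "e = {a, b}" by (auto simp: card_2_iff)
    then show "\<exists>y\<in>{y. {x, y} \<in> eset G}. e = {x, y}"
      using e by (auto simp: insert_commute)
  qed (auto simp: doubleton_eq_iff)
  then show ?thesis
    by (simp add: vertex_degree_def bij_betw_same_card)
qed

lemma vertex_degree_le_max_degree:
  assumes "finite_simple_graph G" "x \<in> vset G"
  shows "vertex_degree G x \<le> max_degree G"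
  unfolding max_degree_def using assms by (intro Max_ge) (auto simp: finite_simple_graph_def)

lemma edge_endpoints:
  assumes "finite_simple_graph G" "{x, y} \<in> eset G"
  shows "x \<in> vset G" "y \<in> vset G" "x \<noteq> y"
proof -
  have "{x, y} \<subseteq> vset G" "card {x, y} = 2"
    using assms by (auto simp: finite_simple_graph_def)
  then show "x \<in> vset G" "y \<in> vset G" "x \<noteq> y" by auto
qed

text \<open>Once an end or the centre is fixed, each of the other two vertices is chosen among the
  neighbours of a vertex already known.\<close>

lemma cherry_system_graph:
  assumes G: "finite_simple_graph G"
  shows "cherry_system (vset G) ((real (max_degree G))\<^sup>2)
    {(x, y, z). {x, y} \<in> eset G \<and> {y, z} \<in> eset G \<and> x \<noteq> z}"
    (is "cherry_system _ ?d ?T")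
proof
  define nb where "nb x = {y. {x, y} \<in> eset G}" for x
  have nb_sub: "nb x \<subseteq> vset G" for x
    using edge_endpoints[OF G] by (auto simp: nb_def)
  show fin: "finite (vset G)" using G by (simp add: finite_simple_graph_def)
  have fin_nb: "finite (nb x)" for x
    using finite_subset[OF nb_sub fin] .
  have card_nb: "real (card (nb x)) \<le> real (max_degree G)" if "x \<in> vset G" for x
    using card_neighbours[OF G] vertex_degree_le_max_degree[OF G that] by (simp add: nb_def)
  \<comment> \<open>\<open>f y\<close> is the vertex to which the last one is attached:
    \<open>y\<close> itself if an end is fixed, and the fixed vertex if that is the centre.\<close>
  have Sigma_le: "real (card P) \<le> ?d"
    if P: "P \<subseteq> Sigma (nb x) (\<lambda>y. nb (f y))" and x: "x \<in> vset G"
      and f: "\<And>y. y \<in> nb x \<Longrightarrow> f y \<in> vset G" for P x f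
  proof -
    have "card P \<le> card (Sigma (nb x) (\<lambda>y. nb (f y)))"
      using P fin_nb by (intro card_mono) auto
    also have "real \<dots> \<le> real (card (nb x)) * real (max_degree G)"
      using f card_nb fin_nb by (intro card_Sigma_le) auto
    also have "\<dots> \<le> ?d"
      using card_nb[OF x] by (simp add: power2_eq_square mult_right_mono)
    finally show ?thesis by simp
  qed
  show "x \<in> vset G \<and> y \<in> vset G \<and> z \<in> vset G \<and> x \<noteq> y \<and> y \<noteq> z \<and> x \<noteq> z"
    if "(x, y, z) \<in> ?T" for x y z
    using that edge_endpoints[OF G] by blast
  show "(z, y, x) \<in> ?T" if "(x, y, z) \<in> ?T" for x y z
    using that by (auto simp: insert_commute)
  show "real (card {(y, z). (x, y, z) \<in> ?T}) \<le> ?d" if "x \<in> vset G" for x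
    by (rule Sigma_le[of _ x "\<lambda>y. y"]) (use that nb_sub in \<open>auto simp: nb_def\<close>)
  show "real (card {(x, z). (x, y, z) \<in> ?T}) \<le> ?d" if "y \<in> vset G" for y
    by (rule Sigma_le[of _ y "\<lambda>_. y"]) (use that in \<open>auto simp: nb_def insert_commute\<close>)
qed

text \<open>A neighbour of the fixed vertex is chosen in \<open>n - 1\<close> ways. Its edge
  prescribes the colour of the second edge, whose endpoint at the centre is known, so local
  boundedness leaves at most \<open>k\<close> choices.\<close>

lemma cherry_system_monochromatic:
  fixes \<chi> :: "nat set \<Rightarrow> 'c"
  assumes \<chi>: "locally_bounded k (complete_graph n) \<chi>" and "n > 0"
  shows "cherry_system {..<n} ((real n - 1) * k)
    {(u, v, w). u < n \<and> v < n \<and> w < n \<and> u \<noteq> v \<and> v \<noteq> w \<and> u \<noteq> w \<and> \<chi> {u, v} = \<chi> {v, w}}"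
    (is "cherry_system _ ?d ?T")
proof
  define nb where "nb v c = {w. w < n \<and> w \<noteq> v \<and> \<chi> {v, w} = c}" for v c
  have card_nb: "real (card (nb v c)) \<le> k" if "v < n" for v c
  proof -
    let ?E = "{e \<in> eset (complete_graph n). v \<in> e \<and> \<chi> e = c}"
    have "finite ?E"
      by (rule finite_subset[of _ "Pow {..<n}"]) (auto simp: complete_graph_def)
    then have "card (nb v c) \<le> card ?E"
      by (intro card_inj_on_le[of "\<lambda>w. {v, w}"])
         (use that in \<open>auto simp: nb_def complete_graph_def inj_on_def doubleton_eq_iff\<close>)
    also have "real \<dots> \<le> k"
      using \<chi> that by (auto simp: locally_bounded_def complete_graph_def)
    finally show ?thesis by simp
  qed
  have fin_nb: "finite (nb v c)" for v c by (simp add: nb_def)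
  have Sigma_le: "real (card P) \<le> ?d"
    if P: "P \<subseteq> Sigma ({..<n} - {x}) (\<lambda>y. nb (f y) (c y))" and x: "x < n"
      and f: "\<And>y. y < n \<Longrightarrow> f y < n" for P x f c
  proof -
    have "card P \<le> card (Sigma ({..<n} - {x}) (\<lambda>y. nb (f y) (c y)))"
      using P fin_nb by (intro card_mono) auto
    also have "real \<dots> \<le> real (card ({..<n} - {x})) * k"
      using f card_nb fin_nb by (intro card_Sigma_le) auto
    also have "\<dots> = ?d" using x by (simp add: of_nat_diff)
    finally show ?thesis by simp
  qed
  show "finite {..<n}" by simp
  show "x \<in> {..<n} \<and> y \<in> {..<n} \<and> z \<in> {..<n} \<and> x \<noteq> y \<and> y \<noteq> z \<and> x \<noteq> z"
    if "(x, y, z) \<in> ?T" for x y z using that by auto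
  show "(z, y, x) \<in> ?T" if "(x, y, z) \<in> ?T" for x y z
    using that by (auto simp: insert_commute)
  show "real (card {(y, z). (x, y, z) \<in> ?T}) \<le> ?d" if "x \<in> {..<n}" for x
    by (rule Sigma_le[of _ x "\<lambda>y. y" "\<lambda>y. \<chi> {x, y}"]) (use that in \<open>auto simp: nb_def\<close>)
  show "real (card {(x, z). (x, y, z) \<in> ?T}) \<le> ?d" if "y \<in> {..<n}" for y
    by (rule Sigma_le[of _ y "\<lambda>_. y" "\<lambda>x. \<chi> {x, y}"]) (use that in \<open>auto simp: nb_def\<close>)
qed

section \<open>From avoided cherries to a properly coloured copy\<close>

theorem corollary4:
  fixes G :: "'a graph" and n \<Delta> :: nat and \<chi> :: "nat set \<Rightarrow> 'c"
  assumes "finite_simple_graph G"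
    and "card (vset G) = n"
    and "max_degree G = \<Delta>"
    and "\<Delta> > 0"
    and "locally_bounded ((real n - 2) / (22.4 * (real \<Delta>)\<^sup>2)) (complete_graph n) \<chi>"
  shows "graph_proper n G \<chi>"
proof -
  define k where "k = (real n - 2) / (22.4 * (real \<Delta>)\<^sup>2)"
  \<comment> \<open>Without vertices, the inserted \<open>0\<close> would make the maximum degree
    \<open>0\<close>.\<close>
  have "vset G \<noteq> {}" using assms(3,4) by (auto simp: max_degree_def)
  then have n: "n > 0"
    using assms(1,2) by (auto simp: finite_simple_graph_def card_gt_0_iff)
  \<comment> \<open>The value of \<open>k\<close> turns the numerical condition on the two cherry
    counts into an equality.\<close>
  have "22.4 * ((real \<Delta>)\<^sup>2 * ((real n - 1) * k)) = (real n - 1) * (real n - 2)"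
    using assms(4) by (simp add: k_def field_simps)
  then obtain \<sigma> where \<sigma>: "inj_on \<sigma> (vset G)" "\<sigma> ` vset G \<subseteq> {..<n}"
    and avoid: "\<And>x y z. {x, y} \<in> eset G \<Longrightarrow> {y, z} \<in> eset G \<Longrightarrow> x \<noteq> z \<Longrightarrow>
      (\<sigma> x, \<sigma> y, \<sigma> z) \<notin> {(u, v, w). u < n \<and> v < n \<and> w < n \<and> u \<noteq> v \<and> v \<noteq> w \<and> u \<noteq> w \<and>
        \<chi> {u, v} = \<chi> {v, w}}"
    using cherry_avoiding_injection[OF cherry_system_graph[OF assms(1)]
        cherry_system_monochromatic[OF assms(5)[folded k_def] n] assms(2)] assms(3)
    by (smt (verit) card_lessThan case_prodI mem_Collect_eq)
  define H where "H = (\<sigma> ` vset G, (\<lambda>e. \<sigma> ` e) ` eset G)"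
  have "is_copy_in G (complete_graph n) H"
    using \<sigma> by (auto simp: is_copy_in_def H_def complete_graph_def)
  moreover have "properly_coloured \<chi> H"
    unfolding properly_coloured_def
  proof (intro ballI impI)
    fix e' f' assume ef: "e' \<in> eset H" "f' \<in> eset H" "e' \<noteq> f' \<and> e' \<inter> f' \<noteq> {}"
    then obtain e f where e: "e \<in> eset G" "e' = \<sigma> ` e" and f: "f \<in> eset G" "f' = \<sigma> ` f"
      by (auto simp: H_def)
    have sub: "e \<subseteq> vset G" "f \<subseteq> vset G" "card e = 2" "card f = 2"
      using assms(1) e f by (auto simp: finite_simple_graph_def)
    \<comment> \<open>Injectivity pulls a common vertex of the image edges back to a common vertex
      of \<open>e\<close> and \<open>f\<close>, so these two edges form a cherry of
      \<open>G\<close>.\<close>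
    have "e \<inter> f \<noteq> {}"
      using ef inj_on_image_Int[OF \<sigma>(1) sub(1,2)] e f by auto
    then obtain y where y: "y \<in> e" "y \<in> f" by blast
    obtain x where x: "e = {x, y}" "x \<noteq> y"
      using sub(3) y(1) by (auto simp: card_2_iff doubleton_eq_iff)
    obtain z where z: "f = {y, z}" "y \<noteq> z"
      using sub(4) y(2) by (auto simp: card_2_iff doubleton_eq_iff)
    have "x \<noteq> z" using ef e f x z by auto
    then have "\<sigma> x \<noteq> \<sigma> z" "\<sigma> x \<noteq> \<sigma> y" "\<sigma> y \<noteq> \<sigma> z" "\<sigma> x < n" "\<sigma> y < n" "\<sigma> z < n"
      using \<sigma> sub x z by (auto simp: inj_on_def)
    then show "\<chi> e' \<noteq> \<chi> f'"
      using avoid[of x y z] e f x z \<open>x \<noteq> z\<close> by auto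
  qed
  ultimately show ?thesis unfolding graph_proper_def by blast
qed

end
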